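(* Let $B$ be a standard Brownian motion, $\alpha>0$, and let $L_b,L_\sigma,K_b,K_\sigma\ge 0$ be constants. Let $\overline{b},\overline{\sigma}:\mathbb{R}_+\times\mathbb{R}\to\mathbb{R}$ satisfy, for all $t\ge 0$ and $x,y\in\mathbb{R}$, $|\overline{b}(t,x)-\overline{b}(t,y)|\le L_b|x-y|$, $|\overline{b}(t,x)|\le K_b$, $|\overline{\sigma}(t,x)^2-\overline{\sigma}(t,y)^2|\le L_\sigma|x-y|$ and $\overline{\sigma}(t,x)^2\le K_\sigma$. Let $D_b,D_\sigma,D_x$ be real constants and $\overline{x}_0\in\mathbb{R}$. For all $N>2$ let $$b^N(t,x):=\overline{b}(t,x)+N^{-\alpha}D_b,\qquad \sigma^N(t,x)^2:=\overline{\sigma}(t,x)^2+N^{-\alpha}D_\sigma,\qquad x_0^N:=\overline{x}_0+N^{-\alpha}D_x,$$ ($D_\sigma$ being such that $\overline{\sigma}(t,x)^2+N^{-\alpha}D_\sigma\ge 0$), and let $X^N$ and $\overline{X}^N$ satisfy, for all $t\ge 0$, $$X^N(t)=x_0^N+\int_0^t b^N(s,X^N(s))\,ds+N^{-\alpha}B(N^\alpha\Lambda^N(t)),\qquad \overline{X}^N(t)=\overline{x}_0+\int_0^t\overline{b}(s,\overline{X}^N(s))\,ds+N^{-\alpha}B(N^\alpha\overline{\Lambda}^N(t)),$$ where $\Lambda^N(t):=\int_0^t\sigma^N(s,X^N(s))^2ds$ and $\overline{\Lambda}^N(t):=\int_0^t\overline{\sigma}(s,\overline{X}^N(s))^2ds$.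 Let $\eta>0$. Then there exists a random variable $\Xi$ (not depending on $N$) with exponential moments such that, for all $N>2$, $$\sup_{0\le t<\infty}\frac{|X^N(t)-\overline{X}^N(t)|}{e^{2(L_b+\eta)t}}\le \Xi\,\frac{\ln N}{N^\alpha}.$$
   Context: A nonnegative random variable $Z$ is said to have (admit) exponential moments if $\mathbb{E}[\exp(\lambda Z)]<\infty$ for some $\lambda>0$. Standing assumption: the equations for $X^N$ and $\overline{X}^N$ (driven by the same Brownian motion $B$) admit strong solutions with continuous paths. Inequalities between random variables are understood almost surely. *)

theory Defs
  imports "HOL-Probability.Probability"
begin

definition standard_brownian_motion :: "'w measure \<Rightarrow> (real \<Rightarrow> 'w \<Rightarrow> real) \<Rightarrow> bool" where
  "standard_brownian_motion M B \<longleftrightarrow>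
     prob_space M \<and>
     (\<forall>t\<ge>0. B t \<in> borel_measurable M) \<and>
     (AE \<omega> in M. B 0 \<omega> = 0) \<and>
     (\<forall>s t. 0 \<le> s \<longrightarrow> s < t \<longrightarrow>
        distributed M lborel (\<lambda>\<omega>. B t \<omega> - B s \<omega>) (normal_density 0 (sqrt (t - s)))) \<and>
     (\<forall>(u :: nat \<Rightarrow> real) n. 0 \<le> u 0 \<longrightarrow> mono u \<longrightarrow>
        prob_space.indep_vars M (\<lambda>_. borel) (\<lambda>i \<omega>. B (u (Suc i)) \<omega> - B (u i) \<omega>) {..<n}) \<and>
     (AE \<omega> in M. continuous_on {0..} (\<lambda>t. B t \<omega>))"

definition clock :: "(real \<Rightarrow> real \<Rightarrow> real) \<Rightarrow> (real \<Rightarrow> 'w \<Rightarrow> real) \<Rightarrow> real \<Rightarrow> 'w \<Rightarrow> real" where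
  "clock \<sigma> X t \<omega> = (LINT s:{0..t}|lebesgue. (\<sigma> s (X s \<omega>))\<^sup>2)"

text \<open>
  Pathwise solutions, on the probability space carrying \<open>B\<close>, of
  \<open>X(t) = x + \<integral>\<^sub>0\<^sup>t b(s, X(s)) ds + N\<^sup>-\<^sup>\<alpha> B(N\<^sup>\<alpha> \<Lambda>(t))\<close>, where \<open>\<Lambda>\<close> is the clock of \<open>X\<close>. The Bochner
  integral of a non-integrable function is \<open>0\<close>, so existence of both integrals is required
  explicitly. Adaptedness to \<open>B\<close> is not required; strong solutions are a special case.
\<close>
definition time_change_solution ::
  "'w measure \<Rightarrow> (real \<Rightarrow> 'w \<Rightarrow> real) \<Rightarrow> real \<Rightarrow> real \<Rightarrow> (real \<Rightarrow> real \<Rightarrow> real) \<Rightarrow>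
   (real \<Rightarrow> real \<Rightarrow> real) \<Rightarrow> real \<Rightarrow> (real \<Rightarrow> 'w \<Rightarrow> real) \<Rightarrow> bool" where
  "time_change_solution M B \<alpha> N b \<sigma> x X \<longleftrightarrow>
     (\<forall>t\<ge>0. X t \<in> borel_measurable M) \<and>
     (AE \<omega> in M. continuous_on {0..} (\<lambda>t. X t \<omega>) \<and>
        (\<forall>t\<ge>0.
           set_integrable lebesgue {0..t} (\<lambda>s. b s (X s \<omega>)) \<and>
           set_integrable lebesgue {0..t} (\<lambda>s. (\<sigma> s (X s \<omega>))\<^sup>2) \<and>
           X t \<omega> = x + (LINT s:{0..t}|lebesgue. b s (X s \<omega>))
                    + N powr (- \<alpha>) * B (N powr \<alpha> * clock \<sigma> X t \<omega>) \<omega>))"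

definition has_exponential_moments :: "'w measure \<Rightarrow> ('w \<Rightarrow> real) \<Rightarrow> bool" where
  "has_exponential_moments M Z \<longleftrightarrow>
     Z \<in> borel_measurable M \<and> (AE \<omega> in M. 0 \<le> Z \<omega>) \<and>
     (\<exists>c>0. (\<integral>\<^sup>+ \<omega>. ennreal (exp (c * Z \<omega>)) \<partial>M) < \<infinity>)"

end

theory Submission
  imports Defs
begin

text \<open>
  All the randomness is put into a global modulus of continuity of the Brownian path:
  almost surely \<open>\<bar>B t - B s\<bar> \<le> C sqrt ((1 + \<bar>t - s\<bar>) (\<xi> + ln (T + 2)))\<close> for all \<open>s, t \<le> T\<close>, where \<open>\<xi>\<close> has
  exponential moments. It comes from chaining over the grids of mesh \<open>4\<^sup>-\<^sup>n\<close>; the variable \<open>\<xi>\<close> is the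
  logarithm of a weighted sum of the exponentials of all squared normalised grid increments.
  The rest is pathwise. The clocks of the two solutions differ by at most
  \<open>L\<^sub>\<sigma> \<integral> \<bar>X - Y\<bar> + O(N\<^sup>-\<^sup>\<alpha> t)\<close>, so by the inequality of arithmetic and geometric means the noise
  difference is at most \<open>\<eta> \<integral> \<bar>X - Y\<bar>\<close> plus a term of order \<open>N\<^sup>-\<^sup>\<alpha> ln N (1 + \<xi>) (1 + t)\<close>, and
  Gronwall's inequality concludes.
\<close>

section \<open>Exponential moments of Brownian grid increments\<close>

text \<open>For summable weights \<open>w\<close>, the sum \<open>W\<close> of all
  \<open>w m * exp (Y m)\<close> has finite mean by Tonelli, and each single term is at most
  \<open>W\<close>. Taking logarithms puts every \<open>Y m\<close> below \<open>ln (1 + W)\<close>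
  up to the price \<open>- ln (w m) = 2 * ln (m + 2)\<close>.\<close>

lemma exponentially_integrable_dominating_variable:
  fixes Y :: "nat \<Rightarrow> 'w \<Rightarrow> real" and C :: ennreal
  assumes "prob_space M"
    and meas: "\<And>m. Y m \<in> borel_measurable M"
    and bound: "\<And>m. (\<integral>\<^sup>+\<omega>. ennreal (exp (Y m \<omega>)) \<partial>M) \<le> C"
    and C: "C < \<infinity>"
  obtains \<xi> where "\<xi> \<in> borel_measurable M" and "\<And>\<omega>. 0 \<le> \<xi> \<omega>"
    and "(\<integral>\<^sup>+\<omega>. ennreal (exp (\<xi> \<omega>)) \<partial>M) < \<infinity>"
    and "AE \<omega> in M. \<forall>m. Y m \<omega> \<le> \<xi> \<omega> + 2 * ln (real m + 2)"
proof -
  interpret prob_space M by fact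
  note meas [measurable]
  define w where "w m = inverse ((real m + 2)\<^sup>2)" for m :: nat
  define W where "W \<omega> = (\<Sum>m. ennreal (w m) * ennreal (exp (Y m \<omega>)))" for \<omega>
  \<comment> \<open>The added 1 makes \<open>\<xi>\<close> nonnegative. Since
    \<open>enn2real\<close> sends infinity to 0, \<open>\<xi>\<close> is real valued everywhere,
    while the domination is obtained only on the almost sure event that \<open>W\<close> is
    finite.\<close>
  define \<xi> where "\<xi> \<omega> = ln (1 + enn2real (W \<omega>))" for \<omega>
  have w_pos: "w m > 0" for m by (simp add: w_def)
  have W [measurable]: "W \<in> borel_measurable M" unfolding W_def by measurable
  have "summable w"
    using summable_ignore_initial_segment [OF inverse_power_summable [of 2, where 'a = real], of 2]
    by (simp add: w_def[abs_def] add.commute)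
  then have w_sum: "(\<Sum>m. ennreal (w m)) < \<infinity>"
    using w_pos by (subst suminf_ennreal2) (auto intro: less_imp_le)
  have "(\<integral>\<^sup>+\<omega>. W \<omega> \<partial>M) = (\<Sum>m. ennreal (w m) * (\<integral>\<^sup>+\<omega>. ennreal (exp (Y m \<omega>)) \<partial>M))"
    unfolding W_def by (subst nn_integral_suminf) (auto simp: nn_integral_cmult)
  also have "\<dots> \<le> (\<Sum>m. ennreal (w m) * C)"
    by (intro suminf_le mult_left_mono bound) auto
  also have "\<dots> = (\<Sum>m. ennreal (w m)) * C" by simp
  also have "\<dots> < \<infinity>" using w_sum C by (simp add: ennreal_mult_less_top)
  finally have W_int: "(\<integral>\<^sup>+\<omega>. W \<omega> \<partial>M) < \<infinity>" .
  then have W_fin: "AE \<omega> in M. W \<omega> \<noteq> \<infinity>"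
    by (intro nn_integral_noteq_infinite) auto
  have exp_\<xi>: "exp (\<xi> \<omega>) = 1 + enn2real (W \<omega>)" for \<omega>
    by (simp add: \<xi>_def add_pos_nonneg)
  show thesis
  proof
    show "\<xi> \<in> borel_measurable M" unfolding \<xi>_def by measurable
    show "0 \<le> \<xi> \<omega>" for \<omega> by (simp add: \<xi>_def)
    have "(\<integral>\<^sup>+\<omega>. ennreal (exp (\<xi> \<omega>)) \<partial>M) \<le> (\<integral>\<^sup>+\<omega>. 1 + W \<omega> \<partial>M)"
      by (intro nn_integral_mono) (auto simp: exp_\<xi> ennreal_plus[of 1, simplified] ennreal_enn2real_if)
    also have "\<dots> = 1 + (\<integral>\<^sup>+\<omega>. W \<omega> \<partial>M)"
      by (subst nn_integral_add) (auto simp: emeasure_space_1)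
    also have "\<dots> < \<infinity>" using W_int by simp
    finally show "(\<integral>\<^sup>+\<omega>. ennreal (exp (\<xi> \<omega>)) \<partial>M) < \<infinity>" .
    show "AE \<omega> in M. \<forall>m. Y m \<omega> \<le> \<xi> \<omega> + 2 * ln (real m + 2)"
      using W_fin
    proof eventually_elim
      case (elim \<omega>)
      show ?case
      proof
        fix m
        have "ennreal (w m * exp (Y m \<omega>)) = (\<Sum>k\<in>{m}. ennreal (w k) * ennreal (exp (Y k \<omega>)))"
          using w_pos[of m] by (simp add: ennreal_mult)
        also have "\<dots> \<le> W \<omega>" unfolding W_def by (intro sum_le_suminf) auto
        also have "\<dots> = ennreal (enn2real (W \<omega>))" using elim by (simp add: top.not_eq_extremum)
        finally have "w m * exp (Y m \<omega>) \<le> exp (\<xi> \<omega>)" by (simp add: exp_\<xi>)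
        then have "exp (Y m \<omega>) \<le> exp (\<xi> \<omega>) * (real m + 2)\<^sup>2"
          by (simp add: w_def field_simps)
        also have "\<dots> = exp (\<xi> \<omega> + 2 * ln (real m + 2))"
          by (simp add: exp_add exp_double)
        finally show "Y m \<omega> \<le> \<xi> \<omega> + 2 * ln (real m + 2)" by simp
      qed
    qed
  qed
qed

text \<open>The exponential factor halves the Gaussian exponent, which leaves a centred normal
  density of doubled variance; \<open>sqrt 2\<close> is the quotient of the two normalising
  constants.\<close>

lemma nn_integral_normal_exp_square:
  assumes "\<sigma> > 0"
  shows "(\<integral>\<^sup>+x. ennreal (normal_density 0 \<sigma> x) * ennreal (exp (x\<^sup>2 / (4 * \<sigma>\<^sup>2))) \<partial>lborel) = ennreal (sqrt 2)"
proof -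
  have "normal_density 0 \<sigma> x * exp (x\<^sup>2 / (4 * \<sigma>\<^sup>2)) = sqrt 2 * normal_density 0 (sqrt 2 * \<sigma>) x" for x
  proof -
    have "- x\<^sup>2 / (2 * \<sigma>\<^sup>2) + x\<^sup>2 / (4 * \<sigma>\<^sup>2) = - x\<^sup>2 / (4 * \<sigma>\<^sup>2)"
      using assms by (simp add: field_simps)
    then have "exp (- x\<^sup>2 / (2 * \<sigma>\<^sup>2)) * exp (x\<^sup>2 / (4 * \<sigma>\<^sup>2)) = exp (- x\<^sup>2 / (4 * \<sigma>\<^sup>2))"
      by (metis exp_add)
    moreover have "1 / sqrt (2 * pi * \<sigma>\<^sup>2) = sqrt 2 / sqrt (2 * pi * (sqrt 2 * \<sigma>)\<^sup>2)"
      using assms by (simp add: power_mult_distrib real_sqrt_mult field_simps)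
    ultimately show ?thesis
      by (simp add: normal_density_def power_mult_distrib mult.assoc)
  qed
  then have "(\<integral>\<^sup>+x. ennreal (normal_density 0 \<sigma> x) * ennreal (exp (x\<^sup>2 / (4 * \<sigma>\<^sup>2))) \<partial>lborel)
      = (\<integral>\<^sup>+x. ennreal (sqrt 2) * ennreal (normal_density 0 (sqrt 2 * \<sigma>) x) \<partial>lborel)"
    by (simp flip: ennreal_mult)
  also have "\<dots> = ennreal (sqrt 2) * (\<integral>\<^sup>+x. ennreal (normal_density 0 (sqrt 2 * \<sigma>) x) \<partial>lborel)"
    by (rule nn_integral_cmult) simp
  also have "(\<integral>\<^sup>+x. ennreal (normal_density 0 (sqrt 2 * \<sigma>) x) \<partial>lborel) = 1"
    using assms by (subst nn_integral_eq_integral) auto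
  finally show ?thesis by simp
qed

text \<open>Dividing by the variance makes the bound independent of \<open>s\<close> and
  \<open>t\<close>, so that one constant serves all grid increments.\<close>

lemma brownian_increment_exp_square:
  assumes BM: "standard_brownian_motion M B" and "0 \<le> s" "s \<le> t"
  shows "(\<integral>\<^sup>+\<omega>. ennreal (exp ((B t \<omega> - B s \<omega>)\<^sup>2 / (4 * (t - s)))) \<partial>M) \<le> 2"
proof (cases "s = t")
  case True
  interpret prob_space M using BM by (simp add: standard_brownian_motion_def)
  \<comment> \<open>Numerator and denominator both vanish; as \<open>0 / 0 = 0\<close>, the
    integrand is constantly 1.\<close>
  show ?thesis using True by (simp add: emeasure_space_1)
next
  case False
  then have "s < t" using assms by simp
  then have "distributed M lborel (\<lambda>\<omega>. B t \<omega> - B s \<omega>) (normal_density 0 (sqrt (t - s)))"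
    using BM \<open>0 \<le> s\<close> by (simp add: standard_brownian_motion_def)
  then have "(\<integral>\<^sup>+x. ennreal (normal_density 0 (sqrt (t - s)) x) * ennreal (exp (x\<^sup>2 / (4 * (t - s)))) \<partial>lborel)
      = (\<integral>\<^sup>+\<omega>. ennreal (exp ((B t \<omega> - B s \<omega>)\<^sup>2 / (4 * (t - s)))) \<partial>M)"
    by (rule distributed_nn_integral) simp
  moreover have "sqrt 2 \<le> 2" by (simp add: real_le_lsqrt)
  ultimately show ?thesis
    using nn_integral_normal_exp_square[of "sqrt (t - s)"] \<open>s < t\<close>
    by (simp add: ennreal_le_iff2 flip: ennreal_numeral)
qed

section \<open>Chaining and the Brownian modulus of continuity\<close>

text \<open>Triangular numbers grow quadratically. The shift by 2 matches the term
  \<open>ln (m + 2)\<close> of the dominating variable and lets the estimate be applied again to a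
  nested pair.\<close>

lemma prod_encode_le: "prod_encode (a, b) + 2 \<le> (a + b + 2)\<^sup>2"
proof -
  have "triangle (a + b) \<le> (a + b)\<^sup>2" 
    unfolding triangle_def by (cases "a + b") (auto simp: power2_eq_square)
  then show ?thesis by (simp add: prod_encode_def power2_eq_square algebra_simps)
qed

text \<open>Two nested pairings raise the scale \<open>P\<close> only to the fourth power.
  Controlling all increments at once therefore costs a factor linear in the level \<open>n\<close>
  and logarithmic in \<open>T\<close>, which is summable against the typical increment size 2^-n on
  mesh 4^-n.\<close>

lemma ln_grid_index_le:
  fixes T :: real
  assumes "0 \<le> T" "real i \<le> 4 ^ n * T" "real j \<le> 4 ^ n * T"
  shows "ln (real (prod_encode (n, prod_encode (i, j))) + 2) \<le> 16 * (real n + 1) * ln (T + 2)"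
proof -
  define b where "b = prod_encode (i, j)"
  define P where "P = 4 ^ n * (2 * (T + 2))"
  have n: "real n + 1 \<le> 4 ^ n"
    using Bernoulli_inequality[of "3 :: real" n] by (simp add: mult.commute)
  have b: "real b + 2 \<le> (real i + real j + 2)\<^sup>2"
    using prod_encode_le[of i j, folded b_def] by (metis (mono_tags) of_nat_add of_nat_le_iff of_nat_numeral of_nat_power)
  have "real (prod_encode (n, b)) + 2 \<le> (real n + (real b + 2))\<^sup>2"
    using prod_encode_le[of n b] by (metis (mono_tags, lifting) add.assoc of_nat_add of_nat_le_iff of_nat_numeral of_nat_power)
  also have "\<dots> \<le> (P\<^sup>2)\<^sup>2"
  proof (rule power_mono)
    have "real n + (real b + 2) \<le> real n * 1 + (real i + real j + 2)\<^sup>2" using b by simp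
    also have "\<dots> \<le> (real n + (real i + real j + 2))\<^sup>2"
      by (simp add: power2_eq_square algebra_simps)
    also have "\<dots> \<le> P\<^sup>2"
    proof (rule power_mono)
      have "real n + (real i + real j + 2) \<le> 2 * 4 ^ n + 2 * (4 ^ n * T)"
        using n assms by simp
      also have "\<dots> \<le> P" by (simp add: P_def algebra_simps)
      finally show "real n + (real i + real j + 2) \<le> P" .
    qed simp
    finally show "real n + (real b + 2) \<le> P\<^sup>2" .
  qed simp
  finally have m: "real (prod_encode (n, b)) + 2 \<le> P ^ 4" by (simp flip: power_mult)
  have P: "P > 0" using assms by (simp add: P_def)
  have L: "1 / 2 \<le> ln (2 :: real)" "ln 2 \<le> ln (T + 2)" "ln 2 \<le> (1 :: real)"
    using assms ln_add_one_self_le_self[of 1] ln2_ge_two_thirds by auto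
  have "ln (real (prod_encode (n, b)) + 2) \<le> ln (P ^ 4)"
    using m P by (subst ln_le_cancel_iff) auto
  also have "\<dots> = 4 * (real n * ln 4 + ln 2 + ln (T + 2))"
    using P assms by (simp add: ln_realpow P_def ln_mult del: distrib_left_numeral)
  also have "ln 4 = 2 * ln (2 :: real)"
    using ln_realpow[of 2 2] by simp
  also have "4 * (real n * (2 * ln 2) + ln 2 + ln (T + 2)) \<le> 4 * (real n * (2 * ln (T + 2)) + ln (T + 2) + ln (T + 2))"
    using L by (intro mult_left_mono add_mono) auto
  also have "\<dots> \<le> 16 * (real n + 1) * ln (T + 2)"
    using L by (simp add: algebra_simps)
  finally show ?thesis by (simp add: b_def)
qed

text \<open>Chaining: each point is joined to its integer part through its grid approximations,
  whose successive increments are summable, and the two integer parts are joined by one increment of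
  level 0. Only fluctuations up to unit scale matter later, so the bound may stay positive as
  \<open>s\<close> tends to \<open>t\<close>; this explains the factor
  \<open>1 + \<bar>t - s\<bar>\<close>.\<close>

lemma grid_modulus_imp_modulus:
  fixes f :: "real \<Rightarrow> real" and \<xi> T s t :: real
  assumes cont: "continuous_on {0..} f" and "0 \<le> \<xi>"
    and grid: "\<And>n i j. i \<le> j \<Longrightarrow> (f (real j / 4 ^ n) - f (real i / 4 ^ n))\<^sup>2
      \<le> 4 * (real j / 4 ^ n - real i / 4 ^ n) * (\<xi> + 2 * ln (real (prod_encode (n, prod_encode (i, j))) + 2))"
    and st: "0 \<le> s" "0 \<le> t" "s \<le> T" "t \<le> T"
  shows "\<bar>f t - f s\<bar> \<le> 132 * sqrt ((1 + \<bar>t - s\<bar>) * (\<xi> + ln (T + 2)))"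
proof -
  define Q where "Q = \<xi> + ln (T + 2)"
  have Q: "0 \<le> Q" using st \<open>0 \<le> \<xi>\<close> by (simp add: Q_def)
  have "0 \<le> T" using st by simp
  have incr: "(f (real j / 4 ^ n) - f (real i / 4 ^ n))\<^sup>2 \<le> 128 * (real j - real i) * (real n + 1) / 4 ^ n * Q"
    if "i \<le> j" "real j \<le> 4 ^ n * T" for n i j
  proof -
    have "ln (real (prod_encode (n, prod_encode (i, j))) + 2) \<le> 16 * (real n + 1) * ln (T + 2)"
      using that \<open>0 \<le> T\<close> by (intro ln_grid_index_le) auto
    moreover have "\<xi> \<le> 32 * (real n + 1) * \<xi>"
      using \<open>0 \<le> \<xi>\<close> mult_right_mono[of 1 "32 * (real n + 1)" \<xi>] by simp
    ultimately have "\<xi> + 2 * ln (real (prod_encode (n, prod_encode (i, j))) + 2) \<le> 32 * (real n + 1) * Q"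
      by (simp add: Q_def algebra_simps)
    then have "4 * (real j / 4 ^ n - real i / 4 ^ n) * (\<xi> + 2 * ln (real (prod_encode (n, prod_encode (i, j))) + 2))
        \<le> 4 * (real j / 4 ^ n - real i / 4 ^ n) * (32 * (real n + 1) * Q)"
      using that by (intro mult_left_mono) (auto simp: divide_right_mono)
    also have "\<dots> = 128 * (real j - real i) * (real n + 1) / 4 ^ n * Q"
      by (simp add: field_simps)
    finally show ?thesis using grid[of i j n] \<open>i \<le> j\<close> by linarith
  qed
  have unit: "\<bar>f x - f (real (nat \<lfloor>x\<rfloor>))\<bar> \<le> 60 * sqrt Q" if x: "0 \<le> x" "x \<le> T" for x
  proof -
    define k where "k n = nat \<lfloor>4 ^ n * x\<rfloor>" for n
    define r where "r n = real (k n) / 4 ^ n" for n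
    have k: "real (k n) \<le> 4 ^ n * x" "4 ^ n * x < real (k n) + 1" for n
      using x unfolding k_def by simp_all
    have step: "\<bar>f (r (Suc n)) - f (r n)\<bar> \<le> 20 * sqrt Q * ((real n + 2) / 2 ^ Suc n)" for n
    proof -
      have "4 * real (k n) \<le> 4 ^ Suc n * x" "4 ^ Suc n * x < 4 * real (k n) + 4"
        using k[of n] by simp_all
      then have "4 * real (k n) < real (k (Suc n)) + 1" "real (k (Suc n)) < 4 * real (k n) + 4"
        using k[of "Suc n"] by linarith+
      \<comment> \<open>Refinement splits a cell into four, so consecutive approximations are at
        most three fine cells apart. Then \<open>128 * 3 \<le> 20\<^sup>2\<close> gives the factor
        20.\<close>
      then have j: "4 * k n \<le> k (Suc n)" "k (Suc n) \<le> 4 * k n + 3" by linarith+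
      have "real (k (Suc n)) \<le> 4 ^ Suc n * T"
        using k(1)[of "Suc n"] mult_left_mono[OF x(2), of "4 ^ Suc n"] by (rule order_trans) simp
      with j have "(f (real (k (Suc n)) / 4 ^ Suc n) - f (real (4 * k n) / 4 ^ Suc n))\<^sup>2
          \<le> 128 * (real (k (Suc n)) - real (4 * k n)) * (real (Suc n) + 1) / 4 ^ Suc n * Q"
        by (intro incr)
      also have "\<dots> \<le> 128 * 3 * (real (Suc n) + 1) / 4 ^ Suc n * Q"
        using j Q by (intro mult_right_mono divide_right_mono mult_left_mono) auto
      also have "\<dots> \<le> 400 * (real n + 2)\<^sup>2 / 4 ^ Suc n * Q"
        using Q by (intro mult_right_mono divide_right_mono) (auto simp: power2_eq_square algebra_simps)
      also have "\<dots> = (20 * sqrt Q * ((real n + 2) / 2 ^ Suc n))\<^sup>2"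
      proof -
        have "(4 :: real) ^ Suc n = (2 ^ Suc n)\<^sup>2" by (simp add: power2_eq_square flip: power_mult_distrib)
        then show ?thesis using Q by (simp add: power_mult_distrib power_divide)
      qed
      finally have "(f (r (Suc n)) - f (r n))\<^sup>2 \<le> (20 * sqrt Q * ((real n + 2) / 2 ^ Suc n))\<^sup>2"
        by (simp add: r_def)
      then show ?thesis using Q by (subst (asm) power2_le_iff_abs_le) auto
    qed
    \<comment> \<open>The terms \<open>(n + 2) / 2 ^ Suc n\<close> for \<open>n < m\<close> sum to
      exactly \<open>3 - (m + 3) / 2 ^ m\<close>; the limit 3 turns 20 into 60.\<close>
    have partial_sum: "\<bar>f (r m) - f (r 0)\<bar> \<le> 20 * sqrt Q * (3 - (real m + 3) / 2 ^ m)" for m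
    proof (induction m)
      case (Suc m)
      have "3 - (real m + 3) / 2 ^ m + (real m + 2) / 2 ^ Suc m = 3 - (real (Suc m) + 3) / 2 ^ Suc m"
        by (simp add: field_simps)
      then have "20 * sqrt Q * (3 - (real m + 3) / 2 ^ m) + 20 * sqrt Q * ((real m + 2) / 2 ^ Suc m)
          = 20 * sqrt Q * (3 - (real (Suc m) + 3) / 2 ^ Suc m)"
        by (metis distrib_left)
      then show ?case using Suc step[of m] by linarith
    qed simp
    have bound: "\<bar>f (r m) - f (r 0)\<bar> \<le> 60 * sqrt Q" for m
    proof -
      have "20 * sqrt Q * (3 - (real m + 3) / 2 ^ m) \<le> 20 * sqrt Q * 3"
        using Q by (intro mult_left_mono) auto
      then show ?thesis using partial_sum[of m] by linarith
    qed
    have "r \<longlonglongrightarrow> x"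
    proof (rule tendsto_sandwich)
      have "x - 1 / 4 ^ n \<le> r n" "r n \<le> x" for n
      proof -
        have "x \<le> (real (k n) + 1) / 4 ^ n" using k(2)[of n] by (simp add: le_divide_eq mult.commute)
        then show "x - 1 / 4 ^ n \<le> r n" by (simp add: r_def add_divide_distrib)
        show "r n \<le> x" using k(1)[of n] by (simp add: r_def divide_le_eq mult.commute)
      qed
      then show "\<forall>\<^sub>F n in sequentially. x - 1 / 4 ^ n \<le> r n" "\<forall>\<^sub>F n in sequentially. r n \<le> x" by simp_all
      have "(\<lambda>n. 1 / 4 ^ n :: real) \<longlonglongrightarrow> 0"
        using LIMSEQ_realpow_zero[of "1 / 4"] by (simp add: power_one_over)
      from tendsto_diff[OF tendsto_const this] show "(\<lambda>n. x - 1 / 4 ^ n) \<longlonglongrightarrow> x" by simp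
    qed auto
    then have "(\<lambda>n. f (r n)) \<longlonglongrightarrow> f x"
      by (rule continuous_on_tendsto_compose[OF cont]) (use x in \<open>simp_all add: r_def\<close>)
    then have "(\<lambda>n. \<bar>f (r n) - f (r 0)\<bar>) \<longlonglongrightarrow> \<bar>f x - f (r 0)\<bar>" by (intro tendsto_intros)
    then have "\<bar>f x - f (r 0)\<bar> \<le> 60 * sqrt Q"
      by (rule LIMSEQ_le_const2) (use bound in auto)
    then show ?thesis by (simp add: r_def k_def)
  qed
  have integer_points: "\<bar>f (real (nat \<lfloor>y\<rfloor>)) - f (real (nat \<lfloor>x\<rfloor>))\<bar> \<le> 12 * sqrt ((1 + \<bar>y - x\<bar>) * Q)"
    if "0 \<le> x" "x \<le> y" "y \<le> T" for x y
  proof -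
    have "(f (real (nat \<lfloor>y\<rfloor>)) - f (real (nat \<lfloor>x\<rfloor>)))\<^sup>2 \<le> 128 * (real (nat \<lfloor>y\<rfloor>) - real (nat \<lfloor>x\<rfloor>)) * Q"
      using incr[of "nat \<lfloor>x\<rfloor>" "nat \<lfloor>y\<rfloor>" 0] that
      by (simp add: nat_mono floor_mono) (use of_int_floor_le order_trans in blast)
    also have "\<dots> \<le> 144 * (1 + \<bar>y - x\<bar>) * Q"
    proof (intro mult_right_mono Q)
      have "real (nat \<lfloor>y\<rfloor>) \<le> y" "x < real (nat \<lfloor>x\<rfloor>) + 1" using that by simp_all
      then have "real (nat \<lfloor>y\<rfloor>) - real (nat \<lfloor>x\<rfloor>) \<le> 1 + \<bar>y - x\<bar>"
        using abs_ge_self[of "y - x"] by linarith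
      then show "128 * (real (nat \<lfloor>y\<rfloor>) - real (nat \<lfloor>x\<rfloor>)) \<le> 144 * (1 + \<bar>y - x\<bar>)"
        using abs_ge_zero[of "y - x"] by argo
    qed
    also have "\<dots> = (12 * sqrt ((1 + \<bar>y - x\<bar>) * Q))\<^sup>2"
      using Q by (simp add: power_mult_distrib)
    finally show ?thesis using Q by (subst (asm) power2_le_iff_abs_le) auto
  qed
  have "\<bar>f (real (nat \<lfloor>t\<rfloor>)) - f (real (nat \<lfloor>s\<rfloor>))\<bar> \<le> 12 * sqrt ((1 + \<bar>t - s\<bar>) * Q)"
    using integer_points[of s t] integer_points[of t s] st
    by (cases "s \<le> t") (auto simp: abs_minus_commute)
  moreover have "60 * sqrt Q \<le> 60 * sqrt ((1 + \<bar>t - s\<bar>) * Q)"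
    using Q mult_right_mono[of 1 "1 + \<bar>t - s\<bar>" Q] by simp
  \<comment> \<open>The constant is 60 + 60 + 12: one chain at each end point and one increment
    between integers, where 12 comes from \<open>128 \<le> 12\<^sup>2\<close>.\<close>
  ultimately have "\<bar>f t - f s\<bar> \<le> 132 * sqrt ((1 + \<bar>t - s\<bar>) * Q)"
    using unit[of s] unit[of t] st by linarith
  then show ?thesis by (simp add: Q_def)
qed

text \<open>The quantifiers over \<open>T\<close>, \<open>s\<close> and \<open>t\<close> stand
  inside the almost sure event, so the estimate may be evaluated at arbitrary random times, in
  particular at the clocks of both solutions.\<close>

lemma brownian_modulus:
  assumes BM: "standard_brownian_motion M B"
  obtains \<xi> where "\<xi> \<in> borel_measurable M" and "\<And>\<omega>. 0 \<le> \<xi> \<omega>"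
    and "(\<integral>\<^sup>+\<omega>. ennreal (exp (\<xi> \<omega>)) \<partial>M) < \<infinity>"
    and "AE \<omega> in M. \<forall>T s t. 0 \<le> s \<longrightarrow> 0 \<le> t \<longrightarrow> s \<le> T \<longrightarrow> t \<le> T \<longrightarrow>
      \<bar>B t \<omega> - B s \<omega>\<bar> \<le> 132 * sqrt ((1 + \<bar>t - s\<bar>) * (\<xi> \<omega> + ln (T + 2)))"
proof -
  have M: "prob_space M" and B [measurable]: "\<And>t. 0 \<le> t \<Longrightarrow> B t \<in> borel_measurable M"
    and cont: "AE \<omega> in M. continuous_on {0..} (\<lambda>t. B t \<omega>)"
    using BM by (auto simp: standard_brownian_motion_def)
  \<comment> \<open>One natural number encodes the level and both grid indices. Codes with
    \<open>i > j\<close> get the harmless value 0, whose exponential has mean 1.\<close>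
  define Y where "Y m \<omega> = (case prod_decode m of (n, ij) \<Rightarrow> case prod_decode ij of (i, j) \<Rightarrow>
      if i \<le> j then (B (real j / 4 ^ n) \<omega> - B (real i / 4 ^ n) \<omega>)\<^sup>2 / (4 * (real j / 4 ^ n - real i / 4 ^ n))
      else 0)" for m \<omega>
  interpret prob_space M by fact
  have bound: "(\<integral>\<^sup>+\<omega>. ennreal (exp (Y m \<omega>)) \<partial>M) \<le> 2" for m
  proof -
    obtain n i j where m: "m = prod_encode (n, prod_encode (i, j))"
      by (metis prod_decode_inverse surj_pair)
    show ?thesis
      using brownian_increment_exp_square[OF BM, of "real i / 4 ^ n" "real j / 4 ^ n"]
      by (cases "i \<le> j") (simp_all add: Y_def m divide_right_mono emeasure_space_1)
  qed
  have meas: "Y m \<in> borel_measurable M" for m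
    unfolding Y_def by (auto split: prod.split)
  obtain \<xi> where \<xi>: "\<xi> \<in> borel_measurable M" "\<And>\<omega>. 0 \<le> \<xi> \<omega>"
    "(\<integral>\<^sup>+\<omega>. ennreal (exp (\<xi> \<omega>)) \<partial>M) < \<infinity>"
    and dom: "AE \<omega> in M. \<forall>m. Y m \<omega> \<le> \<xi> \<omega> + 2 * ln (real m + 2)"
    using exponentially_integrable_dominating_variable[of M Y 2] M meas bound by auto
  have "AE \<omega> in M. \<forall>T s t. 0 \<le> s \<longrightarrow> 0 \<le> t \<longrightarrow> s \<le> T \<longrightarrow> t \<le> T \<longrightarrow>
      \<bar>B t \<omega> - B s \<omega>\<bar> \<le> 132 * sqrt ((1 + \<bar>t - s\<bar>) * (\<xi> \<omega> + ln (T + 2)))"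
    using dom cont
  proof eventually_elim
    case (elim \<omega>)
    have grid: "(B (real j / 4 ^ n) \<omega> - B (real i / 4 ^ n) \<omega>)\<^sup>2
      \<le> 4 * (real j / 4 ^ n - real i / 4 ^ n) * (\<xi> \<omega> + 2 * ln (real (prod_encode (n, prod_encode (i, j))) + 2))"
      if "i \<le> j" for n i j
    \<comment> \<open>For equal indices both sides vanish; otherwise the normalising factor is
      positive and can be multiplied out.\<close>
    proof (cases "i = j")
      case False
      then have "0 < 4 * (real j / 4 ^ n - real i / 4 ^ n)"
        using that by (simp add: divide_strict_right_mono)
      moreover have "(B (real j / 4 ^ n) \<omega> - B (real i / 4 ^ n) \<omega>)\<^sup>2 / (4 * (real j / 4 ^ n - real i / 4 ^ n))
          \<le> \<xi> \<omega> + 2 * ln (real (prod_encode (n, prod_encode (i, j))) + 2)"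
        using elim(1)[rule_format, of "prod_encode (n, prod_encode (i, j))"] that by (simp add: Y_def)
      ultimately show ?thesis
        by (subst (asm) pos_divide_le_eq) (auto simp: mult.commute)
    qed simp
    show ?case
      using grid_modulus_imp_modulus[where f = "\<lambda>t. B t \<omega>" and \<xi> = "\<xi> \<omega>"] elim(2) \<xi>(2) grid by blast
  qed
  with \<xi> show thesis by (rule that)
qed

section \<open>Gronwall's inequality and the pathwise comparison\<close>

lemma gronwall:
  fixes f :: "real \<Rightarrow> real"
  assumes cont: "continuous_on {0..t} f" and "0 \<le> t" "0 \<le> K"
    and le: "\<And>s. 0 \<le> s \<Longrightarrow> s \<le> t \<Longrightarrow> f s \<le> a + K * integral {0..s} f"
  shows "f t \<le> a * exp (K * t)"
proof -
  \<comment> \<open>Integrating factor: the hypothesis makes the derivative of \<open>G\<close>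
    nonpositive, hence \<open>G t \<le> G 0 = a\<close>.\<close>
  define G where "G s = (a + K * integral {0..s} f) * exp (- (K * s))" for s
  have deriv: "(G has_real_derivative K * (f s - (a + K * integral {0..s} f)) * exp (- (K * s))) (at s within {0..t})"
    if "s \<in> {0..t}" for s
    unfolding G_def
    by (rule derivative_eq_intros integral_has_real_derivative[OF cont that] refl)+ (simp add: algebra_simps)
  have "G t \<le> G 0"
  proof (rule DERIV_nonpos_imp_decreasing_open[where f = G and a = 0 and b = t])
    fix s assume s: "0 < s" "s < t"
    then have "(G has_real_derivative K * (f s - (a + K * integral {0..s} f)) * exp (- (K * s))) (at s)"
      using deriv[of s] by (simp add: at_within_Icc_at)
    moreover have "K * (f s - (a + K * integral {0..s} f)) * exp (- (K * s)) \<le> 0"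
      using le[of s] s \<open>0 \<le> K\<close> by (intro mult_nonpos_nonneg mult_nonneg_nonpos) auto
    ultimately show "\<exists>y. DERIV G s :> y \<and> y \<le> 0" by blast
  next
    show "continuous_on {0..t} G"
      unfolding continuous_on_eq_continuous_within using deriv DERIV_continuous by blast
  qed fact
  then have "a + K * integral {0..t} f \<le> a * exp (K * t)"
    by (simp add: G_def exp_minus field_simps)
  then show ?thesis using le[of t] \<open>0 \<le> t\<close> by simp
qed

lemma set_integral_diff_le:
  fixes f g h :: "'a \<Rightarrow> real"
  assumes "set_integrable M A f" "set_integrable M A g" "set_integrable M A h"
    and "\<And>x. x \<in> A \<Longrightarrow> \<bar>f x - g x\<bar> \<le> h x"
  shows "\<bar>(LINT x:A|M. f x) - (LINT x:A|M. g x)\<bar> \<le> (LINT x:A|M. h x)"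
proof -
  have fg: "set_integrable M A (\<lambda>x. f x - g x)" using assms by simp
  have "\<bar>(LINT x:A|M. f x) - (LINT x:A|M. g x)\<bar> = norm (LINT x:A|M. f x - g x)"
    using assms by (simp add: set_integral_diff)
  also have "\<dots> \<le> (LINT x:A|M. norm (f x - g x))"
    by (rule set_integral_norm_bound) fact
  also have "\<dots> \<le> (LINT x:A|M. h x)"
    using assms set_integrable_norm[OF fg] by (intro set_integral_mono) auto
  finally show ?thesis .
qed


lemma set_integral_Icc_bounds:
  fixes f :: "real \<Rightarrow> real"
  assumes f: "set_integrable lebesgue {0..t} f" and "0 \<le> t"
    and bounds: "\<And>s. 0 \<le> s \<Longrightarrow> s \<le> t \<Longrightarrow> 0 \<le> f s \<and> f s \<le> K"
  shows "0 \<le> (LINT s:{0..t}|lebesgue. f s)" and "(LINT s:{0..t}|lebesgue. f s) \<le> K * t"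
proof -
  have "integral {0..t} f \<le> integral {0..t} (\<lambda>_. K)"
    using set_lebesgue_integral_eq_integral(1)[OF f] bounds by (intro integral_le) auto
  then show "(LINT s:{0..t}|lebesgue. f s) \<le> K * t"
    using \<open>0 \<le> t\<close> by (simp add: set_lebesgue_integral_eq_integral(2)[OF f] mult.commute)
  show "0 \<le> (LINT s:{0..t}|lebesgue. f s)"
    unfolding set_lebesgue_integral_eq_integral(2)[OF f]
    using set_lebesgue_integral_eq_integral(1)[OF f] bounds by (intro integral_nonneg) auto
qed

text \<open>Deterministic estimate for one path, with \<open>P\<close> standing for N^\<alpha> and
  \<open>\<beta>\<close> for the Brownian path. The free parameter \<open>\<kappa>\<close> balances
  two effects: a large \<open>\<kappa>\<close> makes the feedback \<open>C * Lv / \<kappa>\<close>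
  of the clock difference small, at the expense of the term \<open>C * \<kappa>\<close> of order
  1/P.\<close>

lemma time_change_integral_inequality:
  fixes x y \<beta> :: "real \<Rightarrow> real" and b bbar v vbar :: "real \<Rightarrow> real \<Rightarrow> real"
  assumes P: "1 \<le> P" and \<xi>: "0 \<le> \<xi>" and \<kappa>: "0 < \<kappa>" and C: "0 \<le> C"
    and cont: "continuous_on {0..} x" "continuous_on {0..} y"
    and lip_b: "\<And>t p q. 0 \<le> t \<Longrightarrow> \<bar>bbar t p - bbar t q\<bar> \<le> Lb * \<bar>p - q\<bar>"
    and lip_v: "\<And>t p q. 0 \<le> t \<Longrightarrow> \<bar>vbar t p - vbar t q\<bar> \<le> Lv * \<bar>p - q\<bar>"
    and vbar: "\<And>t p. 0 \<le> t \<Longrightarrow> 0 \<le> vbar t p \<and> vbar t p \<le> Kv"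
    and b: "\<And>t p. 0 \<le> t \<Longrightarrow> b t p = bbar t p + Db / P"
    and v: "\<And>t p. 0 \<le> t \<Longrightarrow> v t p = vbar t p + Dv / P" "\<And>t p. 0 \<le> t \<Longrightarrow> 0 \<le> v t p"
    and int: "set_integrable lebesgue {0..t} (\<lambda>s. b s (x s))" "set_integrable lebesgue {0..t} (\<lambda>s. v s (x s))"
      "set_integrable lebesgue {0..t} (\<lambda>s. bbar s (y s))" "set_integrable lebesgue {0..t} (\<lambda>s. vbar s (y s))"
    and x: "x t = x0 + Dx / P + (LINT s:{0..t}|lebesgue. b s (x s))
      + \<beta> (P * (LINT s:{0..t}|lebesgue. v s (x s))) / P"
    and y: "y t = x0 + (LINT s:{0..t}|lebesgue. bbar s (y s))
      + \<beta> (P * (LINT s:{0..t}|lebesgue. vbar s (y s))) / P"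
    and modulus: "\<And>T r s. 0 \<le> r \<Longrightarrow> 0 \<le> s \<Longrightarrow> r \<le> T \<Longrightarrow> s \<le> T \<Longrightarrow>
      \<bar>\<beta> s - \<beta> r\<bar> \<le> 2 * C * sqrt ((1 + \<bar>s - r\<bar>) * (\<xi> + ln (T + 2)))"
    and t: "0 \<le> t"
  shows "\<bar>x t - y t\<bar> \<le>
    (\<bar>Dx\<bar> + \<bar>Db\<bar> * t + C * (1 + \<bar>Dv\<bar> * t) / \<kappa> + C * \<kappa> * (\<xi> + ln (P * ((Kv + \<bar>Dv\<bar>) * t) + 2))) / P
    + (Lb + C * Lv / \<kappa>) * integral {0..t} (\<lambda>s. \<bar>x s - y s\<bar>)"
proof -
  define I where "I = integral {0..t} (\<lambda>s. \<bar>x s - y s\<bar>)"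
  define \<Lambda> where "\<Lambda> = (LINT s:{0..t}|lebesgue. v s (x s))"
  define \<Lambda>' where "\<Lambda>' = (LINT s:{0..t}|lebesgue. vbar s (y s))"
  \<comment> \<open>A common horizon for both rescaled clocks, at which the modulus is
    applied.\<close>
  define T where "T = P * ((Kv + \<bar>Dv\<bar>) * t)"
  define q where "q = \<xi> + ln (T + 2)"
  have abs_P: "\<bar>c / P\<bar> = \<bar>c\<bar> / P" for c using P by simp
  have "continuous_on {0..t} x" "continuous_on {0..t} y"
    using cont by (auto intro: continuous_on_subset)
  then have affine_cont: "continuous_on {0..t} (\<lambda>s. c * \<bar>x s - y s\<bar> + d)" for c d
    by (intro continuous_intros)
  have affine_int: "set_integrable lebesgue {0..t} (\<lambda>s. c * \<bar>x s - y s\<bar> + d)" for c d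
    using affine_cont by (rule absolutely_integrable_continuous_real)
  have affine: "(LINT s:{0..t}|lebesgue. c * \<bar>x s - y s\<bar> + d) = c * I + d * t" for c d
  proof -
    have "(\<lambda>s. \<bar>x s - y s\<bar>) integrable_on {0..t}"
      using affine_cont[of 1 0] by (simp add: integrable_continuous_real)
    then have "((\<lambda>s. \<bar>x s - y s\<bar>) has_integral I) {0..t}"
      unfolding I_def by (rule integrable_integral)
    then have "((\<lambda>s. c * \<bar>x s - y s\<bar> + d) has_integral (c * I + (t - 0) *\<^sub>R d)) {0..t}"
      using t by (intro has_integral_add has_integral_mult_right has_integral_const_real[of d 0 t, simplified content_real[OF t]])
    then show ?thesis
      by (simp add: set_lebesgue_integral_eq_integral(2)[OF affine_int] integral_unique mult.commute)
  qed
  have drift: "\<bar>(LINT s:{0..t}|lebesgue. b s (x s)) - (LINT s:{0..t}|lebesgue. bbar s (y s))\<bar>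
      \<le> Lb * I + \<bar>Db\<bar> / P * t"
    unfolding affine[symmetric]
  proof (rule set_integral_diff_le[OF int(1,3) affine_int])
    fix s assume "s \<in> {0..t}"
    then show "\<bar>b s (x s) - bbar s (y s)\<bar> \<le> Lb * \<bar>x s - y s\<bar> + \<bar>Db\<bar> / P"
      using lip_b[of s "x s" "y s"] b[of s "x s"] abs_P[of Db]
      by (smt (verit) atLeastAtMost_iff)
  qed
  have clocks: "\<bar>\<Lambda> - \<Lambda>'\<bar> \<le> Lv * I + \<bar>Dv\<bar> / P * t"
    unfolding affine[symmetric] \<Lambda>_def \<Lambda>'_def
  proof (rule set_integral_diff_le[OF int(2,4) affine_int])
    fix s assume "s \<in> {0..t}"
    then show "\<bar>v s (x s) - vbar s (y s)\<bar> \<le> Lv * \<bar>x s - y s\<bar> + \<bar>Dv\<bar> / P"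
      using lip_v[of s "x s" "y s"] v(1)[of s "x s"] abs_P[of Dv]
      by (smt (verit) atLeastAtMost_iff)
  qed
  have Dv: "Dv / P \<le> \<bar>Dv\<bar>"
    using P divide_left_mono[of 1 P "\<bar>Dv\<bar>"] divide_right_mono[OF abs_ge_self[of Dv], of P] by simp
  have v_le: "0 \<le> v s (x s) \<and> v s (x s) \<le> Kv + \<bar>Dv\<bar>" if "0 \<le> s" for s
    using v[OF that] vbar[OF that, of "x s"] Dv by (smt (verit))
  have vbar_le: "0 \<le> vbar s (y s) \<and> vbar s (y s) \<le> Kv + \<bar>Dv\<bar>" if "0 \<le> s" for s
    using vbar[OF that, of "y s"] by (smt (verit))
  have \<Lambda>: "0 \<le> P * \<Lambda>" "P * \<Lambda> \<le> T" "0 \<le> P * \<Lambda>'" "P * \<Lambda>' \<le> T"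
    unfolding T_def \<Lambda>_def \<Lambda>'_def
    using set_integral_Icc_bounds[OF int(2) t, of "Kv + \<bar>Dv\<bar>"] set_integral_Icc_bounds[OF int(4) t, of "Kv + \<bar>Dv\<bar>"]
      v_le vbar_le P
    by (auto intro!: mult_left_mono)
  have q: "0 \<le> q" using \<Lambda> \<xi> by (simp add: q_def)
  have "\<bar>\<beta> (P * \<Lambda>) - \<beta> (P * \<Lambda>')\<bar> \<le> 2 * C * sqrt ((1 + \<bar>P * \<Lambda> - P * \<Lambda>'\<bar>) * q)"
    unfolding q_def by (rule modulus) fact+
  \<comment> \<open>Inserting \<open>\<kappa>\<close> and its inverse before the
    arithmetic-geometric mean inequality makes the square root linear in the clock difference.
    Gronwall's inequality can then absorb that difference.\<close>
  also have "\<dots> = 2 * C * sqrt (((1 + \<bar>P * \<Lambda> - P * \<Lambda>'\<bar>) / \<kappa>) * (\<kappa> * q))"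
    using \<kappa> by simp
  also have "\<dots> \<le> 2 * C * (((1 + \<bar>P * \<Lambda> - P * \<Lambda>'\<bar>) / \<kappa> + \<kappa> * q) / 2)"
    using \<kappa> q C by (intro mult_left_mono arith_geo_mean_sqrt) auto
  also have "\<dots> = C * ((1 + P * \<bar>\<Lambda> - \<Lambda>'\<bar>) / \<kappa> + \<kappa> * q)"
  proof -
    have "\<bar>P * \<Lambda> - P * \<Lambda>'\<bar> = P * \<bar>\<Lambda> - \<Lambda>'\<bar>"
      using P by (simp add: abs_mult flip: right_diff_distrib)
    then show ?thesis by simp
  qed
  also have "\<dots> \<le> C * ((1 + P * (Lv * I + \<bar>Dv\<bar> / P * t)) / \<kappa> + \<kappa> * q)"
    using clocks C P \<kappa> by (intro mult_left_mono add_right_mono divide_right_mono add_left_mono) auto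
  also have "\<dots> = P * (C * Lv / \<kappa> * I) + (C * (1 + \<bar>Dv\<bar> * t) / \<kappa> + C * \<kappa> * q)"
    using P \<kappa> by (simp add: field_simps)
  finally have "\<bar>\<beta> (P * \<Lambda>) - \<beta> (P * \<Lambda>')\<bar> / P
      \<le> (P * (C * Lv / \<kappa> * I) + (C * (1 + \<bar>Dv\<bar> * t) / \<kappa> + C * \<kappa> * q)) / P"
    using P by (intro divide_right_mono) auto
  also have "\<dots> = C * Lv / \<kappa> * I + (C * (1 + \<bar>Dv\<bar> * t) / \<kappa> + C * \<kappa> * q) / P"
    using P by (simp add: add_divide_distrib)
  finally have noise: "\<bar>\<beta> (P * \<Lambda>) / P - \<beta> (P * \<Lambda>') / P\<bar>
      \<le> C * Lv / \<kappa> * I + (C * (1 + \<bar>Dv\<bar> * t) / \<kappa> + C * \<kappa> * q) / P"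
    by (simp only: abs_P diff_divide_distrib[symmetric])
  have "\<bar>x t - y t\<bar> \<le> \<bar>Dx\<bar> / P + (Lb * I + \<bar>Db\<bar> / P * t)
      + (C * Lv / \<kappa> * I + (C * (1 + \<bar>Dv\<bar> * t) / \<kappa> + C * \<kappa> * q) / P)"
    using x y drift noise abs_P[of Dx] unfolding \<Lambda>_def \<Lambda>'_def by linarith
  also have "\<dots> = (\<bar>Dx\<bar> + \<bar>Db\<bar> * t + C * (1 + \<bar>Dv\<bar> * t) / \<kappa> + C * \<kappa> * q) / P + (Lb + C * Lv / \<kappa>) * I"
    by (simp add: add_divide_distrib distrib_right)
  finally show ?thesis by (simp add: I_def q_def T_def)
qed


text \<open>One factor \<open>exp ((L + \<eta>) * t)\<close> comes from Gronwall's inequality, and a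
  second one absorbs the linear growth
  \<open>1 + t \<le> (1 + 1 / \<eta>) * (1 + \<eta> * t)\<close>. This is the origin of the 2 in the
  exponent.\<close>

lemma gronwall_affine:
  fixes f :: "real \<Rightarrow> real"
  assumes cont: "continuous_on {0..} f" and "0 \<le> L" "0 < \<eta>" "0 \<le> a" "0 \<le> t"
    and le: "\<And>s. 0 \<le> s \<Longrightarrow> f s \<le> a * (1 + s) + (L + \<eta>) * integral {0..s} f"
  shows "f t \<le> a * (1 + 1 / \<eta>) * exp (2 * (L + \<eta>) * t)"
proof -
  have "f t \<le> a * (1 + t) * exp ((L + \<eta>) * t)"
  proof (rule gronwall)
    show "continuous_on {0..t} f" using cont by (rule continuous_on_subset) auto
    fix s assume s: "0 \<le> s" "s \<le> t"
    then have "a * (1 + s) \<le> a * (1 + t)" using \<open>0 \<le> a\<close> by (intro mult_left_mono) auto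
    then show "f s \<le> a * (1 + t) + (L + \<eta>) * integral {0..s} f" using le[of s] s by linarith
  qed (use assms in auto)
  also have "\<dots> \<le> a * ((1 + 1 / \<eta>) * exp ((L + \<eta>) * t)) * exp ((L + \<eta>) * t)"
  proof (intro mult_right_mono mult_left_mono)
    have "1 + t \<le> (1 + 1 / \<eta>) * (1 + \<eta> * t)"
      using assms by (simp add: field_simps)
    also have "\<dots> \<le> (1 + 1 / \<eta>) * exp ((L + \<eta>) * t)"
    proof (rule mult_left_mono)
      have "1 + \<eta> * t \<le> 1 + (L + \<eta>) * t" using assms by (simp add: distrib_right)
      also have "\<dots> \<le> exp ((L + \<eta>) * t)" by (rule exp_ge_add_one_self)
      finally show "1 + \<eta> * t \<le> exp ((L + \<eta>) * t)" .
    qed (use assms in auto)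
    finally show "1 + t \<le> (1 + 1 / \<eta>) * exp ((L + \<eta>) * t)" .
  qed (use assms in auto)
  also have "\<dots> = a * (1 + 1 / \<eta>) * exp (2 * (L + \<eta>) * t)"
    by (simp add: algebra_simps flip: exp_add)
  finally show ?thesis .
qed

text \<open>The rate \<open>ln N\<close> arises here: the logarithm of the rescaled horizon
  contributes \<open>\<alpha> * ln N\<close>, and since N > 2 gives \<open>1 \<le> 2 * ln N\<close>,
  every term free of N can be multiplied by \<open>2 * ln N\<close>. Products of
  \<open>1 + \<xi>\<close> and \<open>1 + t\<close> then dominate the remaining dependence on the
  path and on time.\<close>

lemma error_coefficient_le:
  fixes N \<alpha> \<xi> t Dx Db c d e K :: real
  assumes N: "2 < N" and nonneg: "0 \<le> \<alpha>" "0 \<le> \<xi>" "0 \<le> t" "0 \<le> Dx" "0 \<le> Db" "0 \<le> c" "0 \<le> d" "0 \<le> e" "0 \<le> K"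
  shows "Dx + Db * t + c * (1 + d * t) + e * (\<xi> + ln (N powr \<alpha> * (K * t) + 2))
    \<le> (2 * (Dx + Db + c * (1 + d)) + e * (\<alpha> + 4 + 2 * K)) * ((1 + \<xi>) * ln N) * (1 + t)"
proof -
  define L where "L = ln N"
  have "ln 2 \<le> L" using N by (simp add: L_def)
  then have L: "1 \<le> 2 * L" using ln2_ge_two_thirds by linarith
  have P: "1 \<le> N powr \<alpha>" using N nonneg by (simp add: ge_one_powr_ge_zero)
  have Kt: "0 \<le> K * t" using nonneg by simp
  have "N powr \<alpha> * (K * t) + 2 \<le> N powr \<alpha> * (K * t + 2)" using P by (simp add: distrib_left)
  then have "ln (N powr \<alpha> * (K * t) + 2) \<le> ln (N powr \<alpha> * (K * t + 2))"
    using P Kt by (intro ln_mono add_nonneg_pos) auto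
  also have "\<dots> = \<alpha> * L + ln (1 + (K * t + 1))"
    using N Kt by (simp add: ln_mult ln_powr L_def add.commute)
  also have "\<dots> \<le> \<alpha> * L + (K * t + 1)"
    using Kt by (intro add_left_mono ln_add_one_self_le_self) auto
  also have "\<dots> \<le> \<alpha> * L + (K * t + 1) * (2 * L)"
    using L Kt mult_left_mono[of 1 "2 * L" "K * t + 1"] by simp
  finally have "e * (\<xi> + ln (N powr \<alpha> * (K * t) + 2)) \<le> e * (\<xi> * (2 * L) + (\<alpha> * L + (K * t + 1) * (2 * L)))"
    using nonneg L mult_left_mono[of 1 "2 * L" \<xi>] by (intro mult_left_mono add_mono) auto
  moreover have "Dx + Db * t + c * (1 + d * t) \<le> (Dx + Db * t + c * (1 + d * t)) * (2 * L)"
    using nonneg L mult_left_mono[of 1 "2 * L" "Dx + Db * t + c * (1 + d * t)"] by simp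
  ultimately have "Dx + Db * t + c * (1 + d * t) + e * (\<xi> + ln (N powr \<alpha> * (K * t) + 2))
      \<le> (2 * (Dx + Db * t + c * (1 + d * t)) + e * (2 * \<xi> + \<alpha> + 2 * K * t + 2)) * L"
    by (simp add: algebra_simps)
  also have "\<dots> \<le> (2 * ((Dx + Db + c * (1 + d)) * ((1 + \<xi>) * (1 + t))) + e * ((\<alpha> + 4 + 2 * K) * ((1 + \<xi>) * (1 + t)))) * L"
  proof -
    have "Dx + Db * t + c * (1 + d * t) \<le> (Dx + Db + c * (1 + d)) * ((1 + \<xi>) * (1 + t))"
      using nonneg by (simp add: algebra_simps)
    moreover have "2 * \<xi> + \<alpha> + 2 * K * t + 2 \<le> (\<alpha> + 4 + 2 * K) * ((1 + \<xi>) * (1 + t))"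
      using nonneg by (simp add: algebra_simps)
    ultimately show ?thesis
      using nonneg L by (intro mult_right_mono add_mono mult_left_mono) auto
  qed
  finally show ?thesis by (simp add: L_def algebra_simps)
qed

section \<open>The uniform estimate with rate ln N / N^\<alpha>\<close>

text \<open>The set \<open>S\<close> of indices covers integer as well as real N > 2, and
  \<open>\<Xi>\<close> is chosen before N. The supremum is taken in \<open>ereal\<close>, so that
  the bound also asserts its finiteness.\<close>

theorem corollary4:
  fixes M :: "'w measure" and B :: "real \<Rightarrow> 'w \<Rightarrow> real"
    and \<alpha> Lb L\<sigma> Kb K\<sigma> Db D\<sigma> Dx xbar \<eta> :: real
    and bbar \<sigma>bar :: "real \<Rightarrow> real \<Rightarrow> real"
    and S :: "real set"
    and bN \<sigma>N :: "real \<Rightarrow> real \<Rightarrow> real \<Rightarrow> real" and xN :: "real \<Rightarrow> real"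
    and X Xbar :: "real \<Rightarrow> real \<Rightarrow> 'w \<Rightarrow> real"
  assumes "standard_brownian_motion M B"
    and "\<alpha> > 0" and "Lb \<ge> 0" and "L\<sigma> \<ge> 0" and "Kb \<ge> 0" and "K\<sigma> \<ge> 0"
    and "\<And>t x y. t \<ge> 0 \<Longrightarrow> \<bar>bbar t x - bbar t y\<bar> \<le> Lb * \<bar>x - y\<bar>"
    and "\<And>t x. t \<ge> 0 \<Longrightarrow> \<bar>bbar t x\<bar> \<le> Kb"
    and "\<And>t x y. t \<ge> 0 \<Longrightarrow> \<bar>(\<sigma>bar t x)\<^sup>2 - (\<sigma>bar t y)\<^sup>2\<bar> \<le> L\<sigma> * \<bar>x - y\<bar>"
    and "\<And>t x. t \<ge> 0 \<Longrightarrow> (\<sigma>bar t x)\<^sup>2 \<le> K\<sigma>"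
    and "S \<subseteq> {2<..}"
    and "\<And>N t x. N \<in> S \<Longrightarrow> t \<ge> 0 \<Longrightarrow> bN N t x = bbar t x + N powr (- \<alpha>) * Db"
    and "\<And>N t x. N \<in> S \<Longrightarrow> t \<ge> 0 \<Longrightarrow> (\<sigma>bar t x)\<^sup>2 + N powr (- \<alpha>) * D\<sigma> \<ge> 0"
    and "\<And>N t x. N \<in> S \<Longrightarrow> t \<ge> 0 \<Longrightarrow> (\<sigma>N N t x)\<^sup>2 = (\<sigma>bar t x)\<^sup>2 + N powr (- \<alpha>) * D\<sigma>"
    and "\<And>N. N \<in> S \<Longrightarrow> xN N = xbar + N powr (- \<alpha>) * Dx"
    and "\<And>N. N \<in> S \<Longrightarrow> time_change_solution M B \<alpha> N (bN N) (\<sigma>N N) (xN N) (X N)"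
    and "\<And>N. N \<in> S \<Longrightarrow> time_change_solution M B \<alpha> N bbar \<sigma>bar xbar (Xbar N)"
    and "\<eta> > 0"
  shows "\<exists>\<Xi>. has_exponential_moments M \<Xi> \<and>
           (\<forall>N\<in>S. AE \<omega> in M.
              (SUP t\<in>{0..}. ereal (\<bar>X N t \<omega> - Xbar N t \<omega>\<bar> / exp (2 * (Lb + \<eta>) * t)))
                \<le> ereal (\<Xi> \<omega> * (ln N / N powr \<alpha>)))"
proof -
  note BM = assms(1) and \<alpha> = assms(2) and Lb = assms(3) and L\<sigma> = assms(4) and K\<sigma> = assms(6)
    and lip_b = assms(7) and lip_\<sigma> = assms(9) and \<sigma>_le = assms(10) and S = assms(11) and bN = assms(12)
    and \<sigma>N = assms(14) and xN = assms(15) and X = assms(16) and Xbar = assms(17) and \<eta> = assms(18)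
  obtain \<xi> where \<xi>: "\<xi> \<in> borel_measurable M" "\<And>\<omega>. 0 \<le> \<xi> \<omega>"
    "(\<integral>\<^sup>+\<omega>. ennreal (exp (\<xi> \<omega>)) \<partial>M) < \<infinity>"
    and modulus: "AE \<omega> in M. \<forall>T s t. 0 \<le> s \<longrightarrow> 0 \<le> t \<longrightarrow> s \<le> T \<longrightarrow> t \<le> T \<longrightarrow>
      \<bar>B t \<omega> - B s \<omega>\<bar> \<le> 132 * sqrt ((1 + \<bar>t - s\<bar>) * (\<xi> \<omega> + ln (T + 2)))"
    using brownian_modulus[OF BM] by blast
  \<comment> \<open>Chosen so that the clock feedback \<open>66 * L\<sigma> / \<kappa>\<close> is at
    most \<open>\<eta>\<close>; the added 1 keeps \<open>\<kappa>\<close> positive when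
    \<open>L\<sigma> = 0\<close>. The modulus constant enters as
    \<open>132 = 2 * 66\<close>.\<close>
  define \<kappa> where "\<kappa> = (66 * L\<sigma> + 1) / \<eta>"
  define K where "K = K\<sigma> + \<bar>D\<sigma>\<bar>"
  \<comment> \<open>\<open>A\<close> is the coefficient from \<open>error_coefficient_le\<close>,
    and the factor in \<open>C\<close> below is the one from \<open>gronwall_affine\<close>.\<close>
  define A where "A = 2 * (\<bar>Dx\<bar> + \<bar>Db\<bar> + 66 / \<kappa> * (1 + \<bar>D\<sigma>\<bar>)) + 66 * \<kappa> * (\<alpha> + 4 + 2 * K)"
  define C where "C = A * (1 + 1 / \<eta>)"
  have \<kappa>: "0 < \<kappa>" "66 * L\<sigma> / \<kappa> \<le> \<eta>"
    using \<eta> L\<sigma> by (simp_all add: \<kappa>_def field_simps add_nonneg_pos)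
  have K: "0 \<le> K" using K\<sigma> by (simp add: K_def)
  have "0 < 66 * \<kappa> * (\<alpha> + 4 + 2 * K)"
    using \<kappa> K \<alpha> by (intro mult_pos_pos) auto
  then have A: "0 < A" unfolding A_def
    using \<kappa> by (intro add_nonneg_pos) auto
  have C: "0 < C" using A \<eta> by (simp add: C_def add_pos_pos)
  define \<Xi> where "\<Xi> \<omega> = C * (1 + \<xi> \<omega>)" for \<omega>
  have "has_exponential_moments M \<Xi>"
    unfolding has_exponential_moments_def
  proof (intro conjI exI)
    show "\<Xi> \<in> borel_measurable M" using \<xi>(1) unfolding \<Xi>_def by measurable
    show "AE \<omega> in M. 0 \<le> \<Xi> \<omega>" using C \<xi>(2) by (simp add: \<Xi>_def)
    \<comment> \<open>At this rate the exponent \<open>1 / C * \<Xi> \<omega>\<close> is just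
      \<open>1 + \<xi> \<omega>\<close>.\<close>
    show "0 < 1 / C" using C by simp
    have "(\<integral>\<^sup>+\<omega>. ennreal (exp (1 / C * \<Xi> \<omega>)) \<partial>M) = (\<integral>\<^sup>+\<omega>. ennreal (exp 1) * ennreal (exp (\<xi> \<omega>)) \<partial>M)"
      using C by (intro nn_integral_cong) (simp add: \<Xi>_def exp_add flip: ennreal_mult)
    also have "\<dots> = ennreal (exp 1) * (\<integral>\<^sup>+\<omega>. ennreal (exp (\<xi> \<omega>)) \<partial>M)"
      using \<xi>(1) by (intro nn_integral_cmult) measurable
    also have "\<dots> < \<infinity>" using \<xi>(3) by (simp add: ennreal_mult_less_top)
    finally show "(\<integral>\<^sup>+\<omega>. ennreal (exp (1 / C * \<Xi> \<omega>)) \<partial>M) < \<infinity>" .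
  qed
  moreover have "AE \<omega> in M. (SUP t\<in>{0..}. ereal (\<bar>X N t \<omega> - Xbar N t \<omega>\<bar> / exp (2 * (Lb + \<eta>) * t)))
      \<le> ereal (\<Xi> \<omega> * (ln N / N powr \<alpha>))" if N: "N \<in> S" for N
  proof -
    have "2 < N" using N S by auto
    define P where "P = N powr \<alpha>"
    have P: "1 \<le> P" using \<open>2 < N\<close> \<alpha> by (simp add: P_def ge_one_powr_ge_zero)
    have powr: "N powr (- \<alpha>) = 1 / P" by (simp add: P_def powr_minus_divide)
    have lnN: "0 \<le> ln N" using \<open>2 < N\<close> by simp
    \<comment> \<open>The modulus and both equations hold for all times on one almost sure event, so
      the supremum over \<open>t\<close> can be estimated path by path.\<close>
    note sol = X[OF N, unfolded time_change_solution_def, THEN conjunct2]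
      Xbar[OF N, unfolded time_change_solution_def, THEN conjunct2]
    show ?thesis using modulus sol
    proof eventually_elim
      case (elim \<omega>)
      define f where "f t = \<bar>X N t \<omega> - Xbar N t \<omega>\<bar>" for t
      have cont: "continuous_on {0..} (\<lambda>t. X N t \<omega>)" "continuous_on {0..} (\<lambda>t. Xbar N t \<omega>)"
        using elim by auto
      have f_le: "f t \<le> A * (1 + \<xi> \<omega>) * (ln N / P) * (1 + t) + (Lb + \<eta>) * integral {0..t} f" if t: "0 \<le> t" for t
      proof -
        have int: "set_integrable lebesgue {0..t} (\<lambda>s. bN N s (X N s \<omega>))"
            "set_integrable lebesgue {0..t} (\<lambda>s. (\<sigma>N N s (X N s \<omega>))\<^sup>2)"
            "set_integrable lebesgue {0..t} (\<lambda>s. bbar s (Xbar N s \<omega>))"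
            "set_integrable lebesgue {0..t} (\<lambda>s. (\<sigma>bar s (Xbar N s \<omega>))\<^sup>2)"
          and eqs: "X N t \<omega> = xN N + (LINT s:{0..t}|lebesgue. bN N s (X N s \<omega>))
              + 1 / P * B (P * clock (\<sigma>N N) (X N) t \<omega>) \<omega>"
            "Xbar N t \<omega> = xbar + (LINT s:{0..t}|lebesgue. bbar s (Xbar N s \<omega>))
              + 1 / P * B (P * clock \<sigma>bar (Xbar N) t \<omega>) \<omega>"
          using elim(2,3) t by (auto simp: powr P_def)
        have sol_eqs: "X N t \<omega> = xbar + Dx / P + (LINT s:{0..t}|lebesgue. bN N s (X N s \<omega>))
              + B (P * (LINT s:{0..t}|lebesgue. (\<sigma>N N s (X N s \<omega>))\<^sup>2)) \<omega> / P"
            "Xbar N t \<omega> = xbar + (LINT s:{0..t}|lebesgue. bbar s (Xbar N s \<omega>))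
              + B (P * (LINT s:{0..t}|lebesgue. (\<sigma>bar s (Xbar N s \<omega>))\<^sup>2)) \<omega> / P"
          using eqs xN[OF N] by (simp_all add: powr clock_def)
        have coeffs: "bN N s p = bbar s p + Db / P" "(\<sigma>N N s p)\<^sup>2 = (\<sigma>bar s p)\<^sup>2 + D\<sigma> / P"
          if "0 \<le> s" for s p
          using bN[OF N that] \<sigma>N[OF N that] by (simp_all add: powr)
        have modulus_at: "\<bar>B s \<omega> - B r \<omega>\<bar> \<le> 2 * 66 * sqrt ((1 + \<bar>s - r\<bar>) * (\<xi> \<omega> + ln (T + 2)))"
          if "0 \<le> r" "0 \<le> s" "r \<le> T" "s \<le> T" for T r s
          using elim(1) that by simp
        have "f t \<le> (\<bar>Dx\<bar> + \<bar>Db\<bar> * t + 66 * (1 + \<bar>D\<sigma>\<bar> * t) / \<kappa> + 66 * \<kappa> * (\<xi> \<omega> + ln (P * ((K\<sigma> + \<bar>D\<sigma>\<bar>) * t) + 2))) / P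
            + (Lb + 66 * L\<sigma> / \<kappa>) * integral {0..t} (\<lambda>s. \<bar>X N s \<omega> - Xbar N s \<omega>\<bar>)"
          unfolding f_def
        proof (rule time_change_integral_inequality[where P = P and \<xi> = "\<xi> \<omega>" and \<kappa> = \<kappa> and C = 66
              and x = "\<lambda>t. X N t \<omega>" and y = "\<lambda>t. Xbar N t \<omega>" and bbar = bbar and Lb = Lb
              and vbar = "\<lambda>s p. (\<sigma>bar s p)\<^sup>2" and Lv = L\<sigma> and Kv = K\<sigma>
              and b = "bN N" and Db = Db and v = "\<lambda>s p. (\<sigma>N N s p)\<^sup>2" and Dv = D\<sigma>
              and t = t and ?x0.0 = xbar and Dx = Dx and \<beta> = "\<lambda>u. B u \<omega>"])
          show "0 \<le> (\<sigma>bar s p)\<^sup>2 \<and> (\<sigma>bar s p)\<^sup>2 \<le> K\<sigma>" if "0 \<le> s" for s p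
            using \<sigma>_le that by simp
        qed (fact P \<xi>(2) \<kappa>(1) cont lip_b lip_\<sigma> coeffs int sol_eqs modulus_at t zero_le_power2 | simp)+
        also have "\<dots> \<le> (A * ((1 + \<xi> \<omega>) * ln N) * (1 + t)) / P + (Lb + \<eta>) * integral {0..t} f"
        proof (intro add_mono divide_right_mono mult_right_mono)
          show "\<bar>Dx\<bar> + \<bar>Db\<bar> * t + 66 * (1 + \<bar>D\<sigma>\<bar> * t) / \<kappa> + 66 * \<kappa> * (\<xi> \<omega> + ln (P * ((K\<sigma> + \<bar>D\<sigma>\<bar>) * t) + 2))
              \<le> A * ((1 + \<xi> \<omega>) * ln N) * (1 + t)"
            using error_coefficient_le[of N \<alpha> "\<xi> \<omega>" t "\<bar>Dx\<bar>" "\<bar>Db\<bar>" "66 / \<kappa>" "\<bar>D\<sigma>\<bar>" "66 * \<kappa>" K]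
              \<open>2 < N\<close> \<alpha> \<xi>(2) t \<kappa> K
            by (simp add: A_def K_def P_def)
          show "(Lb + 66 * L\<sigma> / \<kappa>) * integral {0..t} (\<lambda>s. \<bar>X N s \<omega> - Xbar N s \<omega>\<bar>) \<le> (Lb + \<eta>) * integral {0..t} f"
          proof -
            have "continuous_on {0..t} f"
              unfolding f_def using cont by (intro continuous_intros; elim continuous_on_subset) auto
            then have "0 \<le> integral {0..t} f"
              by (intro integral_nonneg integrable_continuous_real) (auto simp: f_def)
            then show ?thesis
              using \<kappa>(2) by (simp add: f_def[abs_def] mult_right_mono)
          qed
        qed (use P in auto)
        finally show ?thesis by (simp add: field_simps)
      qed
      show ?case
      proof (rule SUP_least)
        fix t :: real assume "t \<in> {0..}"
        then have "f t \<le> A * (1 + \<xi> \<omega>) * (ln N / P) * (1 + 1 / \<eta>) * exp (2 * (Lb + \<eta>) * t)"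
          using A \<xi>(2)[of \<omega>] lnN P
          by (intro gronwall_affine[OF _ Lb \<eta> _ _ f_le])
            (auto simp: f_def[abs_def] intro!: continuous_intros cont)
        also have "A * (1 + \<xi> \<omega>) * (ln N / P) * (1 + 1 / \<eta>) = \<Xi> \<omega> * (ln N / N powr \<alpha>)"
          by (simp add: \<Xi>_def C_def P_def)
        finally show "ereal (\<bar>X N t \<omega> - Xbar N t \<omega>\<bar> / exp (2 * (Lb + \<eta>) * t)) \<le> ereal (\<Xi> \<omega> * (ln N / N powr \<alpha>))"
          by (simp add: f_def divide_le_eq)
      qed
    qed
  qed
  ultimately show ?thesis by blast
qed

end
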